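(* Let $(\Gamma,\Lambda)$ be a Hecke pair and let $\phi\colon \Gamma\to G$ be a TDLC completion of $(\Gamma,\Lambda)$. Then precomposition with $\phi$ induces an isomorphism of $\mathbb{R}$-vector spaces $$\phi^*\colon \operatorname{Hom}_{\mathrm{top}}(G,\mathbb{R})\xrightarrow{\ \cong\ }\operatorname{Hom}_{\mathrm{top}}(\Gamma,\mathbb{R})_\Lambda,\qquad \psi\mapsto\psi\circ\phi,$$ where $\operatorname{Hom}_{\mathrm{top}}(\Gamma,\mathbb{R})_\Lambda$ denotes the space of continuous homomorphisms $\Gamma\to\mathbb{R}$ that vanish on $\Lambda$.
   Context: For a topological group $G$, $\operatorname{Hom}_{\mathrm{top}}(G,\mathbb{R})$ is the real vector space of continuous group homomorphisms $G\to(\mathbb{R},+)$ (called characters). Two subgroups of a group are commensurate if their intersection has finite index in both; a subgroup is commensurated if it is commensurate to all its conjugates. A Hecke pair $(\Gamma,\Lambda)$ consists of a Hausdorff topological group $\Gamma$ and an open commensurated subgroup $\Lambda\subseteq\Gamma$. TDLC means totally disconnected locally compact (Hausdorff). A TDLC completion of $(\Gamma,\Lambda)$ is a TDLC group $G$ together with a continuous homomorphism $\phi\colon\Gamma\to G$ with dense image (not necessarily injective) such that $\Lambda=\phi^{-1}(L)$ for some compact open subgroup $L\subseteq G$. *)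

theory Defs
  imports
    "HOL-Analysis.Analysis"
    "HOL-Algebra.Coset"
    "Jordan_Normal_Form.Missing_VectorSpace"
begin

section \<open>Topological groups\<close>

locale top_group = group G for G (structure) and T +
  assumes topspace_eq: "topspace T = carrier G"
    and continuous_mult: "continuous_map (prod_topology T T) T (\<lambda>(x, y). x \<otimes> y)"
    and continuous_inv: "continuous_map T T (\<lambda>x. inv x)"

definition totally_disconnected_space :: "'a topology \<Rightarrow> bool"
  where "totally_disconnected_space T \<longleftrightarrow> (\<forall>C. connectedin T C \<longrightarrow> (\<exists>x. C \<subseteq> {x}))"

locale tdlc_group = top_group +
  assumes Hausdorff: "Hausdorff_space T"
    and locally_compact: "locally_compact_space T"
    and totally_disconnected: "totally_disconnected_space T"

section \<open>Commensurated subgroups and Hecke pairs\<close>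

definition commensurate :: "('a, 'm) monoid_scheme \<Rightarrow> 'a set \<Rightarrow> 'a set \<Rightarrow> bool"
  where "commensurate G H K \<longleftrightarrow>
    finite (rcosets\<^bsub>G\<lparr>carrier := H\<rparr>\<^esub> (H \<inter> K)) \<and>
    finite (rcosets\<^bsub>G\<lparr>carrier := K\<rparr>\<^esub> (H \<inter> K))"

definition commensurated :: "('a, 'm) monoid_scheme \<Rightarrow> 'a set \<Rightarrow> bool"
  where "commensurated G H \<longleftrightarrow> subgroup H G \<and>
    (\<forall>g \<in> carrier G. commensurate G H (g <#\<^bsub>G\<^esub> H #>\<^bsub>G\<^esub> inv\<^bsub>G\<^esub> g))"

locale hecke_pair = top_group \<Gamma> T for \<Gamma> (structure) and T and \<Lambda> +
  assumes Hausdorff: "Hausdorff_space T"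
    and open_subgroup: "openin T \<Lambda>"
    and commensurated: "commensurated \<Gamma> \<Lambda>"

locale tdlc_completion = \<Gamma>: hecke_pair \<Gamma> T\<^sub>\<Gamma> \<Lambda> + G: tdlc_group G T\<^sub>G
  for \<Gamma> :: "('a, 'm) monoid_scheme" and T\<^sub>\<Gamma> and \<Lambda>
    and G :: "('b, 'n) monoid_scheme" and T\<^sub>G +
  fixes \<phi> :: "'a \<Rightarrow> 'b"
  assumes hom: "\<phi> \<in> hom \<Gamma> G"
    and continuous: "continuous_map T\<^sub>\<Gamma> T\<^sub>G \<phi>"
    and dense_image: "Abstract_Topology.closure_of T\<^sub>G (\<phi> ` carrier \<Gamma>) = carrier G"
    and preimage: "\<exists>L. subgroup L G \<and> openin T\<^sub>G L \<and> compactin T\<^sub>G L \<and>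
                       \<Lambda> = {x \<in> carrier \<Gamma>. \<phi> x \<in> L}"

section \<open>Spaces of characters\<close>

abbreviation real_field :: "real ring"
  where "real_field \<equiv> \<lparr>carrier = UNIV, mult = (*), one = 1, zero = 0, add = (+)\<rparr>"

text \<open>
  Characters are taken to be extensional, so that two of them are equal as soon as
  they agree on the carrier of the group. The fields \<open>mult\<close> and \<open>one\<close> come from the
  underlying ring record and carry no meaning in a module.
\<close>

definition Hom_top :: "('a, 'm) monoid_scheme \<Rightarrow> 'a topology \<Rightarrow> (real, 'a \<Rightarrow> real) module"
  where "Hom_top G T =
    \<lparr>carrier = {f \<in> extensional (carrier G).
                  f \<in> hom G (add_monoid real_field) \<and> continuous_map T euclideanreal f},
     mult = undefined,
     one = undefined,
     zero = (\<lambda>x \<in> carrier G. 0),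
     add = (\<lambda>f g. \<lambda>x \<in> carrier G. f x + g x),
     smult = (\<lambda>c f. \<lambda>x \<in> carrier G. c * f x)\<rparr>"

definition Hom_top_vanishing ::
    "('a, 'm) monoid_scheme \<Rightarrow> 'a topology \<Rightarrow> 'a set \<Rightarrow> (real, 'a \<Rightarrow> real) module"
  where "Hom_top_vanishing G T H =
    (Hom_top G T)\<lparr>carrier := {f \<in> carrier (Hom_top G T). \<forall>x \<in> H. f x = 0}\<rparr>"

text \<open>The locale \<open>linear_map\<close> includes that both sides are vector spaces over the field.\<close>

definition vectorspace_iso ::
    "('k, 'r) ring_scheme \<Rightarrow> ('k, 'v, 'm) module_scheme \<Rightarrow> ('k, 'w, 'n) module_scheme \<Rightarrow>
     ('v \<Rightarrow> 'w) \<Rightarrow> bool"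
  where "vectorspace_iso K V W F \<longleftrightarrow> linear_map K V W F \<and> bij_betw F (carrier V) (carrier W)"

end

theory Submission
  imports Defs
begin

text \<open>
  A character of \<open>G\<close> maps the compact subgroup \<open>L\<close> to a bounded subgroup of the reals, hence
  to \<open>0\<close>; so its pullback vanishes on \<open>\<Lambda>\<close>. Injectivity is density of the image. Conversely, a
  homomorphism \<open>f\<close> vanishing on \<open>\<Lambda>\<close> extends to \<open>G\<close> by assigning to \<open>g\<close> the value \<open>f \<gamma>\<close> for
  any \<open>\<gamma>\<close> with \<open>\<phi> \<gamma> \<in> g L\<close>; this is constant on the open cosets of \<open>L\<close>, hence continuous.
\<close>

section \<open>Vector spaces of characters and elementary facts on topological groups\<close>

lemma field_real_field: "field real_field"
proof (rule field.intro)
  have "cring real_field"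
    by (rule cringI, rule abelian_groupI, rule_tac [7] comm_monoidI)
      (auto simp: distrib_right intro: exI[of _ "- x" for x])
  then show "domain real_field"
    by (auto intro!: domain.intro domain_axioms.intro)
  show "field_axioms real_field"
  proof
    have "x \<in> Units real_field" if "x \<noteq> 0" for x
      using that by (auto simp: Units_def intro!: exI[of _ "1 / x"])
    then show "Units real_field = carrier real_field - {\<zero>\<^bsub>real_field\<^esub>}"
      by (auto simp: Units_def)
  qed
qed

lemma Hom_top_vanishing_iff:
  "f \<in> carrier (Hom_top_vanishing G T H) \<longleftrightarrow>
    f \<in> extensional (carrier G) \<and>
    (\<forall>x \<in> carrier G. \<forall>y \<in> carrier G. f (x \<otimes>\<^bsub>G\<^esub> y) = f x + f y) \<and>
    continuous_map T euclideanreal f \<and> (\<forall>x \<in> H. f x = 0)"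
  by (auto simp: Hom_top_vanishing_def Hom_top_def hom_def)

lemma Hom_top_vanishing_simps [simp]:
  "zero (Hom_top_vanishing G T H) = (\<lambda>x \<in> carrier G. 0)"
  "add (Hom_top_vanishing G T H) f g = (\<lambda>x \<in> carrier G. f x + g x)"
  "smult (Hom_top_vanishing G T H) c f = (\<lambda>x \<in> carrier G. c * f x)"
  by (simp_all add: Hom_top_vanishing_def Hom_top_def)

text \<open>Makes the full character space an instance of the vanishing one, so that the module
  axioms and the membership criterion are proved only once.\<close>

lemma Hom_top_vanishing_empty: "Hom_top_vanishing G T {} = Hom_top G T"
  by (simp add: Hom_top_vanishing_def Hom_top_def)

text \<open>Characters are extensional, so every operation on them is wrapped in
  \<open>restrict\<close>; continuity does not see values off the space.\<close>

lemma continuous_map_restrict_topspace: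
  "topspace T = A \<Longrightarrow> continuous_map T T' (restrict f A) \<longleftrightarrow> continuous_map T T' f"
  using continuous_map_eq[of T T' f "restrict f A"] continuous_map_eq[of T T' "restrict f A" f]
  by auto

context top_group
begin

text \<open>Treats both module operations at once: sums come from a = b = 1, scalar multiples from b
  = 0.\<close>

lemma Hom_top_vanishing_linear_combination:
  assumes "H \<subseteq> carrier G"
    and f: "f \<in> carrier (Hom_top_vanishing G T H)" and g: "g \<in> carrier (Hom_top_vanishing G T H)"
  shows "(\<lambda>x \<in> carrier G. a * f x + b * g x) \<in> carrier (Hom_top_vanishing G T H)"
  using assms unfolding Hom_top_vanishing_iff
  by (auto simp: continuous_map_restrict_topspace topspace_eq algebra_simps
      intro!: continuous_map_add continuous_map_real_mult_left)

lemma Hom_top_vanishing_zero: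
  assumes "H \<subseteq> carrier G"
  shows "(\<lambda>x \<in> carrier G. 0) \<in> carrier (Hom_top_vanishing G T H)"
  using assms unfolding Hom_top_vanishing_iff
  by (auto simp: continuous_map_restrict_topspace topspace_eq)

lemma Hom_top_vanishing_add:
  assumes "H \<subseteq> carrier G"
    and "f \<in> carrier (Hom_top_vanishing G T H)" and "g \<in> carrier (Hom_top_vanishing G T H)"
  shows "(\<lambda>x \<in> carrier G. f x + g x) \<in> carrier (Hom_top_vanishing G T H)"
  using Hom_top_vanishing_linear_combination[OF assms, of 1 1] by simp

lemma Hom_top_vanishing_smult:
  assumes "H \<subseteq> carrier G" and "f \<in> carrier (Hom_top_vanishing G T H)"
  shows "(\<lambda>x \<in> carrier G. c * f x) \<in> carrier (Hom_top_vanishing G T H)"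
  using Hom_top_vanishing_linear_combination[OF assms assms(2), of c 0] by simp

lemma vectorspace_Hom_top_vanishing:
  assumes H: "H \<subseteq> carrier G"
  shows "vectorspace real_field (Hom_top_vanishing G T H)"
proof -
  let ?V = "Hom_top_vanishing G T H"
  \<comment> \<open>Adding zero or scaling by one yields a restricted function, which equals f only
    because f is \<open>undefined\<close> off the carrier.\<close>
  have ext: "f x = undefined" if "f \<in> carrier ?V" and "x \<notin> carrier G" for f x
    using that by (auto simp: Hom_top_vanishing_iff extensional_def)
  have "abelian_group ?V"
  proof (rule abelian_groupI)
    fix f assume f: "f \<in> carrier ?V"
    show "\<zero>\<^bsub>?V\<^esub> \<oplus>\<^bsub>?V\<^esub> f = f"
      using ext[OF f] by (auto simp: fun_eq_iff)
    show "\<exists>g \<in> carrier ?V. g \<oplus>\<^bsub>?V\<^esub> f = \<zero>\<^bsub>?V\<^esub>"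
      by (rule bexI[OF _ Hom_top_vanishing_smult[OF H f, of "-1"]]) (auto simp: fun_eq_iff)
  qed (auto simp: Hom_top_vanishing_zero Hom_top_vanishing_add H fun_eq_iff)
  moreover have "cring real_field"
    using field_real_field by (simp add: field_def domain_def)
  ultimately have "module real_field ?V"
  proof (intro moduleI)
    fix f assume f: "f \<in> carrier ?V"
    show "\<one>\<^bsub>real_field\<^esub> \<odot>\<^bsub>?V\<^esub> f = f"
      using ext[OF f] by (auto simp: fun_eq_iff)
  qed (auto simp: Hom_top_vanishing_smult H fun_eq_iff algebra_simps)
  then show ?thesis
    using field_real_field by (rule vectorspace.intro)
qed

lemma vectorspace_Hom_top: "vectorspace real_field (Hom_top G T)"
  using vectorspace_Hom_top_vanishing[of "{}"] by (simp add: Hom_top_vanishing_empty)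

text \<open>The left factor describes cosets of an open subgroup; the right factor is needed for the
  multiplicativity of the extended character.\<close>

lemma openin_translate:
  assumes "openin T U" and a: "a \<in> carrier G" and b: "b \<in> carrier G"
  shows "openin T {x \<in> carrier G. a \<otimes> x \<otimes> b \<in> U}"
proof -
  have mult: "continuous_map T T (\<lambda>x. f x \<otimes> g x)"
    if "continuous_map T T f" and "continuous_map T T g" for f g
    using continuous_map_compose[OF continuous_map_pairedI[OF that] continuous_mult]
    by (simp add: o_def)
  have "continuous_map T T (\<lambda>x. a \<otimes> x \<otimes> b)"
    using a b by (intro mult) (auto simp: topspace_eq)
  from openin_continuous_map_preimage[OF this \<open>openin T U\<close>] show ?thesis
    by (simp add: topspace_eq)
qed

text \<open>Additivity is a bare equation here and in the next lemmas, so that they also apply to a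
  map whose continuity is still to be shown.\<close>

lemma character_one:
  assumes "\<And>x y. x \<in> carrier G \<Longrightarrow> y \<in> carrier G \<Longrightarrow> f (x \<otimes> y) = f x + (f y :: real)"
  shows "f \<one> = 0"
  using assms[of \<one> \<one>] by simp

lemma character_inv_mult:
  assumes f: "\<And>x y. x \<in> carrier G \<Longrightarrow> y \<in> carrier G \<Longrightarrow> f (x \<otimes> y) = f x + (f y :: real)"
    and "x \<in> carrier G" and "y \<in> carrier G"
  shows "f (inv x \<otimes> y) = f y - f x"
  using f[of "inv x" x] f[of "inv x" y] character_one[of f, OF f] assms by simp

lemma character_pow:
  assumes f: "\<And>x y. x \<in> carrier G \<Longrightarrow> y \<in> carrier G \<Longrightarrow> f (x \<otimes> y) = f x + (f y :: real)"
    and x: "x \<in> carrier G"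
  shows "f (x [^] n) = real n * f x"
  by (induction n) (simp_all add: f x character_one[of f, OF f] algebra_simps)

text \<open>All powers of x lie in L, where compactness bounds f, but f takes the value n * f x at
  the n-th power. A nonzero f x would exceed any bound.\<close>

lemma character_vanishes_on_compact_subgroup:
  assumes f: "\<And>x y. x \<in> carrier G \<Longrightarrow> y \<in> carrier G \<Longrightarrow> f (x \<otimes> y) = f x + f y"
    and cont: "continuous_map T euclideanreal f"
    and L: "subgroup L G" and compact: "compactin T L" and x: "x \<in> L"
  shows "f x = 0"
proof (rule ccontr)
  assume "f x \<noteq> 0"
  have "compact (f ` L)"
    using image_compactin[OF compact cont] by simp
  then obtain B where B: "\<And>y. y \<in> L \<Longrightarrow> \<bar>f y\<bar> \<le> B"
    using compact_imp_bounded bounded_iff by (metis image_eqI real_norm_def)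
  obtain n :: nat where n: "B < n * \<bar>f x\<bar>"
    using reals_Archimedean3[of "\<bar>f x\<bar>"] \<open>f x \<noteq> 0\<close> by auto
  interpret L: subgroup L G by (rule L)
  have pow: "x [^] k \<in> L" for k :: nat
    by (induction k) (auto simp: x)
  have "\<bar>f (x [^] n)\<bar> = n * \<bar>f x\<bar>"
    using x L.subset by (simp add: character_pow[of f, OF f] subset_iff abs_mult)
  then show False
    using B[OF pow[of n]] n by simp
qed

end

section \<open>Pullback of characters along the completion map\<close>

context tdlc_completion
begin

lemma \<Lambda>_subset: "\<Lambda> \<subseteq> carrier \<Gamma>"
  using preimage by blast

lemma \<phi>_closed: "x \<in> carrier \<Gamma> \<Longrightarrow> \<phi> x \<in> carrier G"
  using hom by (auto simp: hom_def)

lemma \<phi>_mult: "x \<in> carrier \<Gamma> \<Longrightarrow> y \<in> carrier \<Gamma> \<Longrightarrow> \<phi> (x \<otimes>\<^bsub>\<Gamma>\<^esub> y) = \<phi> x \<otimes>\<^bsub>G\<^esub> \<phi> y"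
  using hom by (auto simp: hom_def)

lemma \<phi>_inv: "x \<in> carrier \<Gamma> \<Longrightarrow> \<phi> (inv\<^bsub>\<Gamma>\<^esub> x) = inv\<^bsub>G\<^esub> \<phi> x"
  by (rule group_hom.hom_inv)
    (simp_all add: group_hom_def group_hom_axioms_def hom \<Gamma>.is_group G.is_group)

text \<open>The working form of density: it picks an element of \<Gamma> whose image meets any open
  condition that some element of G satisfies.\<close>

lemma dense:
  assumes "openin T\<^sub>G U" and "x \<in> U"
  obtains \<gamma> where "\<gamma> \<in> carrier \<Gamma>" and "\<phi> \<gamma> \<in> U"
proof -
  have "T\<^sub>G closure_of (\<phi> ` carrier \<Gamma>) = topspace T\<^sub>G"
    using dense_image by (simp add: G.topspace_eq)
  then have "\<phi> ` carrier \<Gamma> \<inter> U \<noteq> {}"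
    using assms unfolding dense_intersects_open by blast
  then show thesis
    using that by blast
qed

text \<open>The restriction makes the composite extensional, as membership in the character space
  demands.\<close>

abbreviation pullback :: "('b \<Rightarrow> real) \<Rightarrow> 'a \<Rightarrow> real"
  where "pullback \<psi> \<equiv> restrict (\<psi> \<circ> \<phi>) (carrier \<Gamma>)"

lemma pullback_closed:
  assumes "\<psi> \<in> carrier (Hom_top G T\<^sub>G)"
  shows "pullback \<psi> \<in> carrier (Hom_top_vanishing \<Gamma> T\<^sub>\<Gamma> \<Lambda>)"
proof -
  have hom: "\<And>x y. x \<in> carrier G \<Longrightarrow> y \<in> carrier G \<Longrightarrow> \<psi> (x \<otimes>\<^bsub>G\<^esub> y) = \<psi> x + \<psi> y"
    and cont: "continuous_map T\<^sub>G euclideanreal \<psi>"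
    using assms by (simp_all add: Hom_top_vanishing_iff flip: Hom_top_vanishing_empty)
  obtain L where L: "subgroup L G" "compactin T\<^sub>G L" "\<Lambda> = {x \<in> carrier \<Gamma>. \<phi> x \<in> L}"
    using preimage by blast
  have "\<psi> (\<phi> x) = 0" if "x \<in> \<Lambda>" for x
    using that L G.character_vanishes_on_compact_subgroup[of \<psi>, OF hom cont L(1,2)] by blast
  then show ?thesis
    using \<Lambda>_subset continuous_map_compose[OF continuous cont]
    by (auto simp: Hom_top_vanishing_iff \<phi>_mult \<phi>_closed hom continuous_map_restrict_topspace
        \<Gamma>.topspace_eq)
qed

lemma linear_map_pullback:
  "linear_map real_field (Hom_top G T\<^sub>G) (Hom_top_vanishing \<Gamma> T\<^sub>\<Gamma> \<Lambda>) pullback"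
proof -
  let ?V = "Hom_top G T\<^sub>G" and ?W = "Hom_top_vanishing \<Gamma> T\<^sub>\<Gamma> \<Lambda>"
  have V: "vectorspace real_field ?V" and W: "vectorspace real_field ?W"
    by (rule G.vectorspace_Hom_top, rule \<Gamma>.vectorspace_Hom_top_vanishing[OF \<Lambda>_subset])
  have "pullback \<in> module_hom real_field ?V ?W"
    using pullback_closed
    by (auto simp: module_hom_def \<phi>_closed fun_eq_iff Hom_top_def)
  with V W show ?thesis
    by (simp add: linear_map_def mod_hom_def mod_hom_axioms_def vectorspace.axioms)
qed

lemma inj_on_pullback: "inj_on pullback (carrier (Hom_top G T\<^sub>G))"
proof (rule inj_onI)
  fix \<psi> \<psi>'
  assume \<psi>: "\<psi> \<in> carrier (Hom_top G T\<^sub>G)" and \<psi>': "\<psi>' \<in> carrier (Hom_top G T\<^sub>G)"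
    and eq: "pullback \<psi> = pullback \<psi>'"
  have "\<psi> (\<phi> x) = \<psi>' (\<phi> x)" if "x \<in> carrier \<Gamma>" for x
    using fun_cong[OF eq, of x] that by simp
  then have agree: "\<psi> y = \<psi>' y" if "y \<in> \<phi> ` carrier \<Gamma>" for y
    using that by blast
  show "\<psi> = \<psi>'"
  proof (rule extensionalityI)
    show "\<psi> \<in> extensional (carrier G)" "\<psi>' \<in> extensional (carrier G)"
      using \<psi> \<psi>' by (simp_all add: Hom_top_def)
    fix x assume "x \<in> carrier G"
    then have "x \<in> T\<^sub>G closure_of (\<phi> ` carrier \<Gamma>)"
      by (simp add: dense_image)
    \<comment> \<open>The reals are Hausdorff, so continuous maps that agree on a set agree on its
      closure.\<close>
    then show "\<psi> x = \<psi>' x"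
      using \<psi> \<psi>' agree
      by (rule_tac forall_in_closure_of_eq[where Y = euclideanreal and f = \<psi> and g = \<psi>'])
        (auto simp: Hom_top_def)
  qed
qed

section \<open>Extension of a character from \<Gamma> to G\<close>

lemma pullback_surj:
  assumes f: "f \<in> carrier (Hom_top_vanishing \<Gamma> T\<^sub>\<Gamma> \<Lambda>)"
  obtains \<psi> where "\<psi> \<in> carrier (Hom_top G T\<^sub>G)" and "pullback \<psi> = f"
proof -
  obtain L where "subgroup L G" and openL: "openin T\<^sub>G L"
    and \<Lambda>: "\<Lambda> = {x \<in> carrier \<Gamma>. \<phi> x \<in> L}"
    using preimage by blast
  interpret L: subgroup L G by fact
  have f_mult: "\<And>x y. x \<in> carrier \<Gamma> \<Longrightarrow> y \<in> carrier \<Gamma> \<Longrightarrow> f (x \<otimes>\<^bsub>\<Gamma>\<^esub> y) = f x + f y"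
    and f_ext: "f \<in> extensional (carrier \<Gamma>)" and f_\<Lambda>: "\<And>x. x \<in> \<Lambda> \<Longrightarrow> f x = 0"
    using f by (simp_all add: Hom_top_vanishing_iff)
  \<comment> \<open>\<open>near g \<gamma>\<close> says that \<open>\<phi> \<gamma>\<close> lies in
    the coset gL. The choice by \<open>SOME\<close> below is harmless because f is constant on all
    such \<gamma>, by \<open>f_eq\<close>.\<close>
  define near where "near g \<gamma> \<longleftrightarrow> \<gamma> \<in> carrier \<Gamma> \<and> inv\<^bsub>G\<^esub> g \<otimes>\<^bsub>G\<^esub> \<phi> \<gamma> \<in> L" for g \<gamma>
  define \<psi> where "\<psi> = (\<lambda>g \<in> carrier G. f (SOME \<gamma>. near g \<gamma>))"
  have f_eq: "f \<gamma> = f \<delta>" if g: "g \<in> carrier G" and "near g \<gamma>" "near g \<delta>" for g \<gamma> \<delta>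
  proof -
    have \<gamma>: "\<gamma> \<in> carrier \<Gamma>" "inv\<^bsub>G\<^esub> g \<otimes>\<^bsub>G\<^esub> \<phi> \<gamma> \<in> L" and \<delta>: "\<delta> \<in> carrier \<Gamma>" "inv\<^bsub>G\<^esub> g \<otimes>\<^bsub>G\<^esub> \<phi> \<delta> \<in> L"
      using that by (simp_all add: near_def)
    \<comment> \<open>Once the inverse in the product below is expanded, this is the factor that
      remains; thus g drops out.\<close>
    have "g \<otimes>\<^bsub>G\<^esub> (inv\<^bsub>G\<^esub> g \<otimes>\<^bsub>G\<^esub> \<phi> \<delta>) = \<phi> \<delta>"
      using g \<delta>(1) by (simp add: \<phi>_closed flip: G.m_assoc)
    then have "\<phi> (inv\<^bsub>\<Gamma>\<^esub> \<gamma> \<otimes>\<^bsub>\<Gamma>\<^esub> \<delta>) = inv\<^bsub>G\<^esub> (inv\<^bsub>G\<^esub> g \<otimes>\<^bsub>G\<^esub> \<phi> \<gamma>) \<otimes>\<^bsub>G\<^esub> (inv\<^bsub>G\<^esub> g \<otimes>\<^bsub>G\<^esub> \<phi> \<delta>)"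
      using g \<gamma>(1) \<delta>(1)
      by (simp add: \<phi>_mult \<phi>_inv \<phi>_closed G.inv_mult_group G.m_assoc)
    also have "\<dots> \<in> L"
      using \<gamma> \<delta> by blast
    finally have "f (inv\<^bsub>\<Gamma>\<^esub> \<gamma> \<otimes>\<^bsub>\<Gamma>\<^esub> \<delta>) = 0"
      using \<gamma> \<delta> by (intro f_\<Lambda>) (simp add: \<Lambda>)
    then show ?thesis
      using \<Gamma>.character_inv_mult[of f, OF f_mult \<gamma>(1) \<delta>(1)] by simp
  qed
  have open_near: "openin T\<^sub>G {x \<in> carrier G. inv\<^bsub>G\<^esub> g \<otimes>\<^bsub>G\<^esub> x \<in> L}" if "g \<in> carrier G" for g
    using G.openin_translate[OF openL, of "inv\<^bsub>G\<^esub> g" "\<one>\<^bsub>G\<^esub>"] that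
    by (simp cong: conj_cong)
  have near_ex: "\<exists>\<gamma>. near g \<gamma>" if "g \<in> carrier G" for g
    using dense[OF open_near[OF that], of g] that by (auto simp: near_def)
  have \<psi>_eq: "\<psi> g = f \<gamma>" if "g \<in> carrier G" and "near g \<gamma>" for g \<gamma>
    using f_eq[OF that(1) someI[of "near g"] that(2)] that by (simp add: \<psi>_def)
  have \<psi>_mult: "\<psi> (g \<otimes>\<^bsub>G\<^esub> h) = \<psi> g + \<psi> h" if g: "g \<in> carrier G" and h: "h \<in> carrier G" for g h
  proof -
    \<comment> \<open>\<delta> is fixed first, because the open condition imposed on \<gamma>
      depends on \<open>\<phi> \<delta>\<close>.\<close>
    obtain \<delta> where \<delta>: "near h \<delta>"
      using near_ex h by blast
    \<comment> \<open>\<open>L\<close> need not be normal, so \<open>\<phi> \<gamma> \<in> g L\<close> alone would not give \<open>\<phi> \<gamma> \<phi> \<delta> \<in> g h L\<close>.\<close>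
    let ?U = "{x \<in> carrier G. inv\<^bsub>G\<^esub> g \<otimes>\<^bsub>G\<^esub> x \<in> L} \<inter>
        {x \<in> carrier G. (inv\<^bsub>G\<^esub> h \<otimes>\<^bsub>G\<^esub> inv\<^bsub>G\<^esub> g) \<otimes>\<^bsub>G\<^esub> x \<otimes>\<^bsub>G\<^esub> \<phi> \<delta> \<in> L}"
    have "openin T\<^sub>G ?U"
      using g h \<delta> by (intro openin_Int open_near G.openin_translate openL)
        (auto simp: near_def \<phi>_closed)
    \<comment> \<open>At x = g the first condition puts the unit in L and the second reduces to
      \<open>near h \<delta>\<close>.\<close>
    moreover have "g \<in> ?U"
      using g h \<delta> by (simp add: near_def G.m_assoc \<phi>_closed)
    ultimately obtain \<gamma> where \<gamma>: "\<gamma> \<in> carrier \<Gamma>" "\<phi> \<gamma> \<in> ?U"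
      using dense by blast
    have "near g \<gamma>" and "near (g \<otimes>\<^bsub>G\<^esub> h) (\<gamma> \<otimes>\<^bsub>\<Gamma>\<^esub> \<delta>)"
      using \<gamma> \<delta> g h
      by (auto simp: near_def \<phi>_mult \<phi>_closed G.m_assoc G.inv_mult_group)
    then show ?thesis
      using \<psi>_eq[of g \<gamma>] \<psi>_eq[of h \<delta>] \<psi>_eq[of "g \<otimes>\<^bsub>G\<^esub> h" "\<gamma> \<otimes>\<^bsub>\<Gamma>\<^esub> \<delta>"] \<gamma>(1) \<delta> g h
      by (simp add: f_mult near_def)
  qed
  have \<psi>_\<phi>: "\<psi> (\<phi> \<gamma>) = f \<gamma>" if "\<gamma> \<in> carrier \<Gamma>" for \<gamma>
    using that by (intro \<psi>_eq) (simp_all add: near_def \<phi>_closed)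
  have \<psi>_L: "\<psi> x = 0" if "x \<in> L" for x
  proof -
    \<comment> \<open>Since \<phi> preserves the unit, this says that the inverse of x lies in
      L.\<close>
    have "near x \<one>\<^bsub>\<Gamma>\<^esub>"
      using that \<phi>_inv[of "\<one>\<^bsub>\<Gamma>\<^esub>"] \<phi>_mult[of "\<one>\<^bsub>\<Gamma>\<^esub>" "\<one>\<^bsub>\<Gamma>\<^esub>"] \<phi>_closed[of "\<one>\<^bsub>\<Gamma>\<^esub>"]
      by (simp add: near_def)
    then show ?thesis
      using \<psi>_eq that \<Gamma>.character_one[of f, OF f_mult] by simp
  qed
  have \<psi>_coset: "\<psi> x = \<psi> g" if "g \<in> carrier G" "x \<in> carrier G" "inv\<^bsub>G\<^esub> g \<otimes>\<^bsub>G\<^esub> x \<in> L" for g x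
    using \<psi>_L[OF that(3)] G.character_inv_mult[of \<psi>, OF \<psi>_mult that(1,2)] by simp
  have "continuous_map T\<^sub>G euclideanreal \<psi>"
    unfolding continuous_map_def
  proof (intro conjI allI impI)
    \<comment> \<open>\<psi> is locally constant: with each point g, the preimage of U contains the
      whole open coset gL.\<close>
    fix U :: "real set"
    let ?P = "{x \<in> topspace T\<^sub>G. \<psi> x \<in> U}"
    show "openin T\<^sub>G ?P"
    proof (subst openin_subopen, intro ballI)
      fix g assume g: "g \<in> ?P"
      then have "{x \<in> carrier G. inv\<^bsub>G\<^esub> g \<otimes>\<^bsub>G\<^esub> x \<in> L} \<subseteq> ?P"
        unfolding G.topspace_eq by (auto dest: \<psi>_coset)
      then show "\<exists>V. openin T\<^sub>G V \<and> g \<in> V \<and> V \<subseteq> ?P"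
        using open_near[of g] g by (intro exI conjI) (auto simp: G.topspace_eq)
    qed
  qed simp
  then have "\<psi> \<in> carrier (Hom_top G T\<^sub>G)"
    using \<psi>_mult by (simp add: Hom_top_vanishing_iff \<psi>_def flip: Hom_top_vanishing_empty)
  moreover have "pullback \<psi> = f"
    using f_ext \<psi>_\<phi> by (intro extensionalityI) auto
  ultimately show thesis
    by (rule that)
qed

end

theorem proposition1:
  fixes \<Gamma> :: "('a, 'm) monoid_scheme" and T\<^sub>\<Gamma> :: "'a topology" and \<Lambda> :: "'a set"
    and G :: "('b, 'n) monoid_scheme" and T\<^sub>G :: "'b topology" and \<phi> :: "'a \<Rightarrow> 'b"
  assumes "hecke_pair \<Gamma> T\<^sub>\<Gamma> \<Lambda>"
    and "tdlc_completion \<Gamma> T\<^sub>\<Gamma> \<Lambda> G T\<^sub>G \<phi>"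
  shows "vectorspace_iso real_field (Hom_top G T\<^sub>G) (Hom_top_vanishing \<Gamma> T\<^sub>\<Gamma> \<Lambda>)
           (\<lambda>\<psi>. restrict (\<psi> \<circ> \<phi>) (carrier \<Gamma>))"
proof -
  interpret tdlc_completion \<Gamma> T\<^sub>\<Gamma> \<Lambda> G T\<^sub>G \<phi> by fact
  have "pullback ` carrier (Hom_top G T\<^sub>G) = carrier (Hom_top_vanishing \<Gamma> T\<^sub>\<Gamma> \<Lambda>)"
  proof (intro equalityI subsetI)
    fix f assume "f \<in> carrier (Hom_top_vanishing \<Gamma> T\<^sub>\<Gamma> \<Lambda>)"
    then obtain \<psi> where "\<psi> \<in> carrier (Hom_top G T\<^sub>G)" and "pullback \<psi> = f"
      by (rule pullback_surj)
    then show "f \<in> pullback ` carrier (Hom_top G T\<^sub>G)"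
      by blast
  qed (use pullback_closed in blast)
  then show ?thesis
    by (simp add: vectorspace_iso_def linear_map_pullback bij_betw_def inj_on_pullback)
qed

end
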